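(* For any tree $T$ with at least $2$ edges, $f_3(n,T)=O(n^{3/2})$.
   Context: All colourings are edge-colourings of the complete graph $K_n$; a colouring is proper if any two edges sharing a vertex receive different colours. Two copies of a graph $H$ in an edge-coloured $K_n$ are colour isomorphic if there is a graph isomorphism between them mapping each edge to an edge of the same colour. A $k$-repeat of $H$ is a collection of $k$ pairwise vertex-disjoint, pairwise colour-isomorphic copies of $H$. For integers $k,n\geq 2$ and a graph $H$, $f_k(n,H)$ is the smallest integer $C$ such that there is a proper edge-colouring of $K_n$ with $C$ colours containing no $k$-repeat of $H$. Asymptotic notation is with respect to $n\to\infty$ with $T$ fixed. *)

theory Defs
  imports "HOL-Library.Landau_Symbols"
begin

text \<open>A graph is a pair of a vertex set and a set of two-element sets of vertices.\<close>

type_synonym 'a graph = "'a set \<times> 'a set set"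

abbreviation verts :: "'a graph \<Rightarrow> 'a set" where
  "verts \<equiv> fst"

abbreviation edges :: "'a graph \<Rightarrow> 'a set set" where
  "edges \<equiv> snd"

definition finite_simple_graph :: "'a graph \<Rightarrow> bool" where
  "finite_simple_graph G \<longleftrightarrow>
     finite (verts G) \<and> (\<forall>e\<in>edges G. e \<subseteq> verts G \<and> card e = 2)"

definition connected_graph :: "'a graph \<Rightarrow> bool" where
  "connected_graph G \<longleftrightarrow> verts G \<noteq> {} \<and>
     (\<forall>u\<in>verts G. \<forall>v\<in>verts G. (u, v) \<in> {(x, y). {x, y} \<in> edges G}\<^sup>*)"

text \<open>The vertices of a cycle are listed once each, in cyclic order.\<close>

definition is_cycle :: "'a graph \<Rightarrow> 'a list \<Rightarrow> bool" where
  "is_cycle G vs \<longleftrightarrow> length vs \<ge> 3 \<and> distinct vs \<and>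
     (\<forall>i<length vs. {vs ! i, vs ! (Suc i mod length vs)} \<in> edges G)"

definition is_tree :: "'a graph \<Rightarrow> bool" where
  "is_tree G \<longleftrightarrow>
     finite_simple_graph G \<and> connected_graph G \<and> (\<nexists>vs. is_cycle G vs)"

definition graph_iso :: "('a \<Rightarrow> 'b) \<Rightarrow> 'a graph \<Rightarrow> 'b graph \<Rightarrow> bool" where
  "graph_iso \<phi> G H \<longleftrightarrow>
     bij_betw \<phi> (verts G) (verts H) \<and> edges H = (\<lambda>e. \<phi> ` e) ` edges G"

definition complete_graph :: "nat \<Rightarrow> nat graph" where
  "complete_graph n = ({..<n}, {e. e \<subseteq> {..<n} \<and> card e = 2})"

definition subgraph :: "'a graph \<Rightarrow> 'a graph \<Rightarrow> bool" where
  "subgraph G H \<longleftrightarrow>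
     finite_simple_graph G \<and> verts G \<subseteq> verts H \<and> edges G \<subseteq> edges H"

definition copy_of :: "'a graph \<Rightarrow> nat \<Rightarrow> nat graph \<Rightarrow> bool" where
  "copy_of H n G \<longleftrightarrow> subgraph G (complete_graph n) \<and> (\<exists>\<phi>. graph_iso \<phi> H G)"

text \<open>A colouring is only relevant on the edges of the coloured graph.\<close>

definition proper_colouring :: "'a graph \<Rightarrow> ('a set \<Rightarrow> nat) \<Rightarrow> bool" where
  "proper_colouring G c \<longleftrightarrow>
     (\<forall>e\<in>edges G. \<forall>e'\<in>edges G. e \<noteq> e' \<and> e \<inter> e' \<noteq> {} \<longrightarrow> c e \<noteq> c e')"

definition colour_isomorphic :: "('a set \<Rightarrow> nat) \<Rightarrow> 'a graph \<Rightarrow> 'a graph \<Rightarrow> bool" where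
  "colour_isomorphic c G G' \<longleftrightarrow>
     (\<exists>\<phi>. graph_iso \<phi> G G' \<and> (\<forall>e\<in>edges G. c (\<phi> ` e) = c e))"

definition is_repeat ::
  "nat \<Rightarrow> nat \<Rightarrow> 'a graph \<Rightarrow> (nat set \<Rightarrow> nat) \<Rightarrow> nat graph set \<Rightarrow> bool" where
  "is_repeat k n H c S \<longleftrightarrow> card S = k \<and> (\<forall>G\<in>S. copy_of H n G) \<and>
     pairwise (\<lambda>G G'. verts G \<inter> verts G' = {} \<and> colour_isomorphic c G G') S"

definition repeat_free_colouring ::
  "nat \<Rightarrow> nat \<Rightarrow> 'a graph \<Rightarrow> nat \<Rightarrow> (nat set \<Rightarrow> nat) \<Rightarrow> bool" where
  "repeat_free_colouring k n H C c \<longleftrightarrow>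
     proper_colouring (complete_graph n) c \<and>
     card (c ` edges (complete_graph n)) = C \<and>
     (\<nexists>S. is_repeat k n H c S)"

definition repeat_number :: "nat \<Rightarrow> nat \<Rightarrow> 'a graph \<Rightarrow> nat" where
  "repeat_number k n H = (LEAST C. \<exists>c. repeat_free_colouring k n H C c)"

text \<open>The minimum is attained if \<open>k \<ge> 2\<close> and \<open>H\<close> has an edge: give all edges distinct colours.\<close>

lemma repeat_number_attained:
  fixes H :: "'a graph"
  assumes "k \<ge> 2" "edges H \<noteq> {}"
  shows "\<exists>c. repeat_free_colouring k n H (repeat_number k n H) c"
proof -
  let ?E = "edges (complete_graph n)"
  have "finite ?E"
    by (rule finite_subset[of _ "Pow {..<n}"]) (auto simp: complete_graph_def)
  then obtain c :: "nat set \<Rightarrow> nat" where c: "inj_on c ?E"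
    using finite_imp_inj_to_nat_seg by blast
  have "\<not> is_repeat k n H c S" for S
  proof
    assume S: "is_repeat k n H c S"
    then have "\<not> card S \<le> Suc 0" and "finite S"
      using assms(1) card.infinite[of S] by (fastforce simp: is_repeat_def)+
    then obtain G G' where G: "G \<in> S" "G' \<in> S" "G \<noteq> G'"
      by (meson card_le_Suc0_iff_eq)
    have dis: "verts G \<inter> verts G' = {}" and col: "colour_isomorphic c G G'"
      and cop: "copy_of H n G" "copy_of H n G'"
      using S G by (auto simp: is_repeat_def pairwise_def)
    obtain \<phi> where \<phi>: "graph_iso \<phi> G G'" "\<forall>e\<in>edges G. c (\<phi> ` e) = c e"
      using col by (auto simp: colour_isomorphic_def)
    have "edges G \<noteq> {}"
      using cop(1) assms(2) by (auto simp: copy_of_def graph_iso_def)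
    then obtain e where e: "e \<in> edges G" by blast
    have e': "\<phi> ` e \<in> edges G'"
      using \<phi>(1) e by (auto simp: graph_iso_def)
    have "e \<in> ?E" "\<phi> ` e \<in> ?E" "e \<subseteq> verts G" "\<phi> ` e \<subseteq> verts G'" "card e = 2"
      using cop e e' by (auto simp: copy_of_def subgraph_def finite_simple_graph_def)
    moreover from this have "\<phi> ` e = e"
      using inj_onD[OF c, of "\<phi> ` e" e] \<phi>(2) e by blast
    ultimately have "e = {}" using dis by auto
    with \<open>card e = 2\<close> show False by simp
  qed
  moreover have "proper_colouring (complete_graph n) c"
    using c by (auto simp: proper_colouring_def dest: inj_onD)
  ultimately have "\<exists>C c. repeat_free_colouring k n H C c"
    by (auto simp: repeat_free_colouring_def)
  then show ?thesis
    unfolding repeat_number_def by (rule LeastI_ex)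
qed

end

theory Submission
  imports Defs "HOL-Algebra.Algebraic_Closure_Type"
begin

text \<open>A tree with at least two edges contains a path with two edges, so it is enough to avoid three
  disjoint colour-isomorphic copies of that path. Let \<open>q\<close> be a power of 3, put the vertices of \<open>K\<^sub>n\<close>
  on points of the field with \<open>q\<^sup>2\<close> elements, where \<open>n \<le> q\<^sup>2 \<le> 9n\<close>, and colour \<open>{x, y}\<close> by the
  circle with diameter \<open>{x, y}\<close> for the anisotropic norm \<open>x\<^sup>q\<^sup>+\<^sup>1\<close>, that is, by
  \<open>(x + y, x\<^sup>q\<^sup>+\<^sup>1 + y\<^sup>q\<^sup>+\<^sup>1)\<close>. The norms lie in the field with \<open>q\<close> elements, so there are at most
  \<open>q\<^sup>3\<close> colours. The middle vertex of a path with two prescribed colours lies on two distinct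
  circles, and these have at most two common points.\<close>

section \<open>Finite fields as fixed points of Frobenius powers\<close>

text \<open>\<open>x ^ q - x\<close> splits over an algebraically closed field, and its derivative
  is -1, so its \<open>q\<close> roots are distinct. They form the subfield with \<open>q\<close>
  elements.\<close>

lemma card_frobenius_fixed:
  assumes "prime CHAR('a::alg_closed_field)" and "q = CHAR('a) ^ k" and "k > 0"
  shows "card {x::'a. x ^ q = x} = q"
proof -
  define p :: "'a poly" where "p = monom 1 q - monom 1 1"
  have q: "q > 1" using assms by (metis one_less_power prime_gt_1_nat)
  have deg: "degree p = q"
    unfolding p_def using q by (subst diff_conv_add_uminus, subst degree_add_eq_left)
      (simp_all add: degree_monom_eq)
  then have p0: "p \<noteq> 0" using q by auto
  have roots: "{x. poly p x = 0} = {x. x ^ q = x}"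
    by (auto simp: p_def poly_monom)
  have "of_nat q = (0::'a)"
    using assms by (simp add: power_0_left)
  then have der: "pderiv p = - 1"
    using q by (simp add: p_def pderiv_diff pderiv_monom monom_0 one_pCons)
  have ord: "order x p = 1" if "poly p x = 0" for x
  proof (rule ccontr)
    assume "order x p \<noteq> 1"
    then have "2 \<le> order x p"
      using that p0 order_root[of p x] by linarith
    then have "[:-x, 1:] ^ 2 dvd p"
      using order_divides by blast
    then obtain r where "p = [:-x, 1:] * ([:-x, 1:] * r)"
      by (metis dvdE mult.assoc power2_eq_square)
    then have "poly (pderiv p) x = 0"
      by (simp add: pderiv_mult del: mult_pCons_left)
    with der show False by simp
  qed
  obtain A where A: "size A = degree p" "p = smult (lead_coeff p) (\<Prod>x\<in>#A. [:-x, 1:])"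
    using alg_closed_imp_factorization[OF p0] by blast
  \<comment> \<open>Nonvanishing is carried through the induction because \<open>proots_mult\<close>
    asks for nonzero factors.\<close>
  have "(\<Prod>x\<in>#B. [:-x, 1:]) \<noteq> 0 \<and> proots (\<Prod>x\<in>#B. [:-x, 1:]) = B" for B :: "'a multiset"
    by (induction B) (auto simp: proots_mult simp del: mult_pCons_left)
  then have "proots p = A"
    using p0 by (subst A(2)) simp
  then have sz: "size (proots p) = q" using A(1) deg by simp
  also have "size (proots p) = (\<Sum>x | poly p x = 0. order x p)"
    using p0 by (simp add: size_multiset_overloaded_eq)
  also have "\<dots> = card {x. poly p x = 0}"
    using ord by simp
  finally show ?thesis using roots by simp
qed

lemma CHAR_finite_3 [simp]: "CHAR(Enum.finite_3) = 3"
proof (rule CHAR_eq_posI)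
  show "of_nat 3 = (0::Enum.finite_3)" by (simp add: numeral_3_eq_3 plus_finite_3_def)
  fix x :: nat assume "0<x" "x < 3"
  then have "x = 1 \<or> x = 2" by auto
  then show "of_nat x \<noteq> (0::Enum.finite_3)" by (auto simp: numeral_2_eq_2 plus_finite_3_def)
qed simp

section \<open>Intersecting circles\<close>

text \<open>Subtracting the two circle equations leaves a linear one, so the common points lie on a
  line, and a line meets a circle at most twice. The point opposite \<open>w\<close> on the first
  circle is \<open>s - w\<close>, so \<open>s\<close> is twice the centre.\<close>

lemma circles_meet_twice:
  fixes x y z s t u v :: "'a::field" and conj :: "'a \<Rightarrow> 'a"
  assumes two: "(2::'a) \<noteq> 0"
    and add: "\<And>x y. conj (x + y) = conj x + conj y"
    and inj: "\<And>x. conj x = 0 \<Longrightarrow> x = 0"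
    and "s \<noteq> t"
    and s: "\<And>w. w \<in> {x, y, z} \<Longrightarrow> w * conj w + (s - w) * conj (s - w) = u"
    and t: "\<And>w. w \<in> {x, y, z} \<Longrightarrow> w * conj w + (t - w) * conj (t - w) = v"
  shows "x = y \<or> x = z \<or> y = z"
proof -
  have diff: "conj (a - b) = conj a - conj b" for a b
    using add[of "a - b" b] by (simp add: algebra_simps)
  \<comment> \<open>\<open>a\<close> and \<open>b\<close> are the chords from \<open>y\<close>,
    \<open>d\<close> is twice the difference of the centres, and \<open>e\<close> is twice the
    vector from the first centre to \<open>y\<close>.\<close>
  define a b d e where "a = x - y" and "b = z - y" and "d = s - t" and "e = y - (s - y)"
  define S T where "S w = w * conj w + (s - w) * conj (s - w)"
    and "T w = w * conj w + (t - w) * conj (t - w)" for w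
  have vals: "S w = u" "T w = v" if "w \<in> {x, y, z}" for w
    using s[OF that] t[OF that] by (simp_all add: S_def T_def)
  have expand: "2 * (w - y) * conj (w - y) + (w - y) * conj e + conj (w - y) * e = S w - S y"
    "(w - y) * conj d + conj (w - y) * d = (T w - T y) - (S w - S y)" for w
    unfolding S_def T_def d_def e_def diff by (simp_all add: algebra_simps)
  have chord: "2 * a * conj a + a * conj e + conj a * e = 0"
    "2 * b * conj b + b * conj e + conj b * e = 0"
    and axis: "a * conj d + conj a * d = 0" "b * conj d + conj b * d = 0"
    unfolding a_def b_def expand by (simp_all add: vals)
  \<comment> \<open>Both chords are orthogonal to the nonzero \<open>d\<close>; eliminating
    \<open>conj d\<close> shows that they are parallel.\<close>
  have "d * (a * conj b - conj a * b) =
      a * (b * conj d + conj b * d) - b * (a * conj d + conj a * d)"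
    by (simp add: algebra_simps)
  then have par: "a * conj b - conj a * b = 0"
    using axis \<open>s \<noteq> t\<close> by (simp add: d_def)
  \<comment> \<open>Eliminating \<open>conj e\<close> from the two chord equations leaves, besides
    the left side, only a multiple of the parallelism relation.\<close>
  have "2 * (a * b * (conj a - conj b)) = b * (2 * a * conj a + a * conj e + conj a * e) -
      a * (2 * b * conj b + b * conj e + conj b * e) + e * (a * conj b - conj a * b)"
    by (simp add: algebra_simps)
  then have "2 * (a * b * (conj a - conj b)) = 0"
    unfolding chord par by simp
  then have "a = 0 \<or> b = 0 \<or> conj (a - b) = 0"
    using two by (simp add: diff)
  then show ?thesis
    using inj[of "a - b"] by (auto simp: a_def b_def)
qed

section \<open>Two-edge paths and repeats\<close>

text \<open>If the edges were pairwise disjoint, a walk starting in one edge could never leave it,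
  so no second edge could be reached.\<close>

lemma connected_graph_has_cherry:
  assumes "finite_simple_graph G" "connected_graph G" "card (edges G) \<ge> 2"
  obtains w y z where "y \<noteq> z" "w \<noteq> y" "w \<noteq> z" "{w, y} \<in> edges G" "{w, z} \<in> edges G"
proof -
  have card2: "card e = 2" "e \<subseteq> verts G" if "e \<in> edges G" for e
    using assms(1) that by (auto simp: finite_simple_graph_def)
  obtain e e' where e: "e \<in> edges G" "e' \<in> edges G" "e \<noteq> e'"
    using assms(3) card_le_Suc0_iff_eq[of "edges G"] card.infinite[of "edges G"]
    by fastforce
  have "\<exists>f\<in>edges G. \<exists>f'\<in>edges G. f \<noteq> f' \<and> f \<inter> f' \<noteq> {}"
  proof (rule ccontr)
    assume disj: "\<not> ?thesis"
    have "e \<noteq> {}" "e' \<noteq> {}" using card2 e by fastforce+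
    then obtain u p where up: "u \<in> e" "p \<in> e'" by blast
    then have "u \<in> verts G" "p \<in> verts G"
      using card2(2) e by auto
    then have "(u, p) \<in> {(x, y). {x, y} \<in> edges G}\<^sup>*"
      using assms(2) by (simp add: connected_graph_def)
    then have "p \<in> e"
    proof (induction rule: rtrancl_induct)
      case (step y z)
      then have "{y, z} \<in> edges G" "{y, z} \<inter> e \<noteq> {}" by auto
      then have "{y, z} = e" using disj e(1) by metis
      then show ?case by blast
    qed (rule up)
    with disj e up show False by (metis disjoint_iff)
  qed
  then obtain f f' w where f: "f \<in> edges G" "f' \<in> edges G" "f \<noteq> f'" "w \<in> f" "w \<in> f'"
    by blast
  obtain y where y: "f = {w, y}" "y \<noteq> w"
    using card2(1)[OF f(1)] f(4) by (auto simp: card_2_iff)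
  obtain z where z: "f' = {w, z}" "z \<noteq> w"
    using card2(1)[OF f(2)] f(5) by (auto simp: card_2_iff)
  show thesis using that[of y z w] y z f by auto
qed

lemma repeat_number_le:
  assumes "repeat_free_colouring k n H C c"
  shows "repeat_number k n H \<le> C"
  unfolding repeat_number_def using assms by (intro Least_le exI)

text \<open>Assumption \<open>c\<close> says that the colour of \<open>{x, y}\<close> determines the circle with diameter
  \<open>{point x, point y}\<close>: the first sum fixes its centre, the second one its radius.\<close>

lemma no_3_repeat_if_circles:
  fixes point :: "nat \<Rightarrow> 'b::field" and conj :: "'b \<Rightarrow> 'b"
  assumes two: "(2::'b) \<noteq> 0"
    and add: "\<And>x y. conj (x + y) = conj x + conj y"
    and inj: "\<And>x. conj x = 0 \<Longrightarrow> x = 0"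
    and point: "inj_on point {..<n}"
    and T: "is_tree T" "card (edges T) \<ge> 2"
    and c: "\<And>e e'. e \<in> edges (complete_graph n) \<Longrightarrow> e' \<in> edges (complete_graph n) \<Longrightarrow> c e = c e' \<Longrightarrow>
      sum point e = sum point e' \<and>
      (\<Sum>x\<in>e. point x * conj (point x)) = (\<Sum>x\<in>e'. point x * conj (point x))"
  shows "\<not> is_repeat 3 n T c S"
proof
  assume S: "is_repeat 3 n T c S"
  then obtain G1 G2 G3 where G: "S = {G1, G2, G3}" "G1 \<noteq> G2" "G1 \<noteq> G3" "G2 \<noteq> G3"
    unfolding is_repeat_def card_3_iff by metis
  have cop: "copy_of T n G1" "copy_of T n G2" "copy_of T n G3"
    using S G by (auto simp: is_repeat_def)
  have disj: "verts G1 \<inter> verts G2 = {}" "verts G1 \<inter> verts G3 = {}" "verts G2 \<inter> verts G3 = {}"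
    and "colour_isomorphic c G1 G2" "colour_isomorphic c G1 G3"
    using S G(2-4) unfolding G(1) is_repeat_def pairwise_insert by blast+
  then obtain f2 f3 where f2: "graph_iso f2 G1 G2" "\<And>e. e \<in> edges G1 \<Longrightarrow> c (f2 ` e) = c e"
    and f3: "graph_iso f3 G1 G3" "\<And>e. e \<in> edges G1 \<Longrightarrow> c (f3 ` e) = c e"
    by (auto simp: colour_isomorphic_def)
  obtain h where h: "graph_iso h T G1"
    using cop by (auto simp: copy_of_def)
  obtain w y z where wyz: "y \<noteq> z" "w \<noteq> y" "w \<noteq> z" "{w, y} \<in> edges T" "{w, z} \<in> edges T"
    using connected_graph_has_cherry T unfolding is_tree_def by metis
  have wyzT: "{w, y, z} \<subseteq> verts T"
    using T wyz by (auto simp: is_tree_def finite_simple_graph_def)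
  define W Y Z where "W = h w" and "Y = h y" and "Z = h z"
  have h_inj: "inj_on h (verts T)" and "h ` verts T = verts G1"
    using h by (auto simp: graph_iso_def bij_betw_def)
  then have WYZ: "W \<in> verts G1" "Y \<in> verts G1" "Z \<in> verts G1" "Y \<noteq> Z" "W \<noteq> Y" "W \<noteq> Z"
    using wyz wyzT by (auto simp: W_def Y_def Z_def dest: inj_onD)
  have edge: "{W, Y} \<in> edges G1" "{W, Z} \<in> edges G1"
  proof -
    have "h ` {w, y} \<in> edges G1" "h ` {w, z} \<in> edges G1"
      using h wyz unfolding graph_iso_def by blast+
    then show "{W, Y} \<in> edges G1" "{W, Z} \<in> edges G1"
      by (simp_all add: W_def Y_def Z_def)
  qed
  have sub: "verts G1 \<subseteq> {..<n}" "edges G1 \<subseteq> edges (complete_graph n)"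
    using cop by (auto simp: copy_of_def subgraph_def complete_graph_def)
  \<comment> \<open>\<open>s\<close> and \<open>u\<close> describe the circle given by the colour of
    \<open>{W, Y}\<close>, and \<open>t\<close> and \<open>v\<close> the one given by
    \<open>{W, Z}\<close>. The centres differ because \<open>Y \<noteq> Z\<close>.\<close>
  define s t where "s = point W + point Y" and "t = point W + point Z"
  define u v where "u = point W * conj (point W) + point Y * conj (point Y)"
    and "v = point W * conj (point W) + point Z * conj (point Z)"
  have "s \<noteq> t"
    using point WYZ sub by (auto simp: s_def t_def dest: inj_onD)
  \<comment> \<open>Preserved colours keep the sums \<open>s\<close> and \<open>t\<close>, which
    express the points of \<open>f Y\<close> and \<open>f Z\<close> through that of
    \<open>f W\<close>. So the middle vertex of every copy lies on the same two circles.\<close>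
  have circle: "point (f W) * conj (point (f W)) + (s - point (f W)) * conj (s - point (f W)) = u \<and>
      point (f W) * conj (point (f W)) + (t - point (f W)) * conj (t - point (f W)) = v \<and>
      f W \<in> {..<n} \<and> f W \<in> verts G"
    if f: "graph_iso f G1 G" "\<And>e. e \<in> edges G1 \<Longrightarrow> c (f ` e) = c e" and G: "copy_of T n G" for f G
  proof -
    have fi: "inj_on f (verts G1)" and fv: "f ` verts G1 = verts G"
      using f by (auto simp: graph_iso_def bij_betw_def)
    have ne: "f W \<noteq> f Y" "f W \<noteq> f Z"
      using fi WYZ by (auto dest: inj_onD)
    have "edges G \<subseteq> edges (complete_graph n)" and Gn: "verts G \<subseteq> {..<n}"
      using G by (auto simp: copy_of_def subgraph_def complete_graph_def)
    moreover have "f ` {W, Y} \<in> edges G" "f ` {W, Z} \<in> edges G"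
      using f(1) edge unfolding graph_iso_def by blast+
    ultimately have "f ` {W, Y} \<in> edges (complete_graph n)" "f ` {W, Z} \<in> edges (complete_graph n)"
      by blast+
    from c[OF this(1) _ f(2)] c[OF this(2) _ f(2)]
    have "point (f W) + point (f Y) = s" "point (f W) + point (f Z) = t"
      "point (f W) * conj (point (f W)) + point (f Y) * conj (point (f Y)) = u"
      "point (f W) * conj (point (f W)) + point (f Z) * conj (point (f Z)) = v"
      using edge sub ne WYZ by (auto simp: s_def t_def u_def v_def)
    moreover from this have "point (f Y) = s - point (f W)" "point (f Z) = t - point (f W)"
      by (auto simp: algebra_simps)
    ultimately show ?thesis using Gn fv WYZ by auto
  qed
  \<comment> \<open>The identity supplies \<open>W\<close> itself as the third common point.\<close>
  have "graph_iso id G1 G1" by (simp add: graph_iso_def)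
  then have c1: "point W * conj (point W) + (s - point W) * conj (s - point W) = u \<and>
      point W * conj (point W) + (t - point W) * conj (t - point W) = v \<and> W \<in> {..<n} \<and> W \<in> verts G1"
    using circle[of id G1] cop by simp
  note c2 = circle[OF f2 cop(2)] and c3 = circle[OF f3 cop(3)]
  have "point W = point (f2 W) \<or> point W = point (f3 W) \<or> point (f2 W) = point (f3 W)"
    by (rule circles_meet_twice[OF two add inj \<open>s \<noteq> t\<close>, where u = u and v = v])
      (use c1 c2 c3 in auto)
  then have "W = f2 W \<or> W = f3 W \<or> f2 W = f3 W"
    using point c1 c2 c3 by (meson inj_onD)
  then show False using disj c1 c2 c3 by (metis disjoint_iff)
qed

section \<open>The colouring over finite fields of characteristic 3\<close>

text \<open>This one field contains the fields with \<open>3 ^ k\<close> and \<open>9 ^ k\<close>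
  elements for every \<open>k > 0\<close>.\<close>

type_synonym F3_closure = "Enum.finite_3 alg_closure"

text \<open>With \<open>q = 3 ^ k\<close> there are \<open>q * q = 9 ^ k\<close> points available in
  \<open>P\<close>, and the colours are coded by pairs from \<open>P \<times> K\<close>, of which
  there are \<open>27 ^ k\<close>.\<close>

lemma repeat_number_3_le:
  assumes "is_tree T" "card (edges T) \<ge> 2" and "k > 0" "n \<le> 9 ^ k"
  shows "repeat_number 3 n T \<le> 27 ^ k"
proof -
  define q :: nat where "q = 3 ^ k"
  have prime: "prime CHAR(F3_closure)"
    by simp
  have qq: "q * q = 3 ^ (2 * k)" by (simp add: q_def power_add mult_2)
  define P :: "F3_closure set" where "P = {x. x ^ (q * q) = x}"
  define K :: "F3_closure set" where "K = {x. x ^ q = x}"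
  have cP: "card P = q * q"
    unfolding P_def by (rule card_frobenius_fixed[OF prime, of _ "2 * k"]) (use assms in \<open>simp_all add: qq\<close>)
  have cK: "card K = q"
    unfolding K_def by (rule card_frobenius_fixed[OF prime, of _ k]) (use assms in \<open>simp_all add: q_def\<close>)
  have q0: "q > 0" by (simp add: q_def)
  have fin: "finite P" "finite K"
    using cP cK q0 by (auto intro: card_ge_0_finite)
  have nP: "n \<le> card P"
    using assms(4) by (simp add: cP q_def flip: power_mult_distrib)
  have add: "(x + y) ^ q = x ^ q + y ^ q" for x y :: F3_closure
    by (rule freshmans_dream'[OF prime, of _ k]) (simp add: q_def)
  have addP: "(x + y) ^ (q * q) = x ^ (q * q) + y ^ (q * q)" for x y :: F3_closure
    by (rule freshmans_dream'[OF prime, of _ "2 * k"]) (simp add: qq)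
  have "of_nat 2 \<noteq> (0::F3_closure)"
    unfolding of_nat_eq_0_iff_char_dvd by simp
  then have two: "(2::F3_closure) \<noteq> 0" by simp
  obtain point :: "nat \<Rightarrow> F3_closure" where point: "inj_on point {..<n}" "point ` {..<n} \<subseteq> P"
    using card_le_inj[of "{..<n}" P] fin nP by auto
  define pcol where "pcol e = (sum point e, \<Sum>x\<in>e. point x * point x ^ q)" for e
  obtain code :: "F3_closure \<times> F3_closure \<Rightarrow> nat" where code: "inj_on code (P \<times> K)"
    using finite_imp_inj_to_nat_seg[of "P \<times> K"] fin by blast
  define c where "c = code \<circ> pcol"
  let ?E = "edges (complete_graph n)"
  have edgeE: "\<exists>x y. e = {x, y} \<and> x \<noteq> y \<and> x < n \<and> y < n" if "e \<in> ?E" for e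
    using that by (auto simp: complete_graph_def card_2_iff)
  \<comment> \<open>The \<open>q\<close>-th power of \<open>x * x ^ q\<close> is
    \<open>x ^ q * x ^ (q * q)\<close>, whose last factor is \<open>x\<close>.\<close>
  have norm: "x * x ^ q \<in> K" if "x \<in> P" for x
    using that by (simp add: P_def K_def power_mult_distrib mult.commute flip: power_mult)
  have pcol: "pcol e \<in> P \<times> K" if e: "e \<in> ?E" for e
  proof -
    obtain x y where xy: "e = {x, y}" "x \<noteq> y" "x < n" "y < n" using edgeE[OF e] by blast
    then have "point x \<in> P" "point y \<in> P" using point by auto
    moreover from this have "point x + point y \<in> P" by (simp add: P_def addP)
    moreover have "a + b \<in> K" if "a \<in> K" "b \<in> K" for a b
      using that by (simp add: K_def add)
    ultimately show ?thesis using norm xy by (simp add: pcol_def)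
  qed
  have cD: "pcol e = pcol e'" if "e \<in> ?E" "e' \<in> ?E" "c e = c e'" for e e'
    using that code pcol by (auto simp: c_def dest: inj_onD)
  have "proper_colouring (complete_graph n) c"
    unfolding proper_colouring_def
  proof (intro ballI impI notI)
    fix e e' assume e: "e \<in> ?E" "e' \<in> ?E" "e \<noteq> e' \<and> e \<inter> e' \<noteq> {}" "c e = c e'"
    obtain w where w: "w \<in> e" "w \<in> e'" using e by blast
    obtain y where y: "e = {w, y}" "y \<noteq> w" "y < n"
      using edgeE[OF e(1)] w by fastforce
    obtain z where z: "e' = {w, z}" "z \<noteq> w" "z < n"
      using edgeE[OF e(2)] w by fastforce
    \<comment> \<open>Equal colours give equal sums, from which the common summand
      \<open>point w\<close> cancels.\<close>
    have "point y = point z"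
      using cD[OF e(1,2,4)] y z by (simp add: pcol_def)
    then show False using point y z e by (auto dest: inj_onD)
  qed
  moreover have "\<not> is_repeat 3 n T c S" for S
  proof (rule no_3_repeat_if_circles[where conj = "\<lambda>x. x ^ q" and point = point])
    show "x ^ q = 0 \<Longrightarrow> x = 0" for x :: F3_closure by simp
    show "sum point e = sum point e' \<and>
        (\<Sum>x\<in>e. point x * point x ^ q) = (\<Sum>x\<in>e'. point x * point x ^ q)"
      if "e \<in> ?E" "e' \<in> ?E" "c e = c e'" for e e'
      using cD[OF that] by (simp add: pcol_def)
  qed (fact two add point(1) assms(1,2))+
  ultimately have "repeat_number 3 n T \<le> card (c ` ?E)"
    by (intro repeat_number_le[where c = c]) (auto simp: repeat_free_colouring_def)
  also have "\<dots> \<le> card (code ` (P \<times> K))"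
    using fin pcol by (intro card_mono) (auto simp: c_def)
  also have "\<dots> \<le> card (P \<times> K)"
    using fin by (intro card_image_le) auto
  also have "\<dots> = 27 ^ k"
    by (simp add: card_cartesian_product cP cK q_def flip: power_mult_distrib)
  finally show ?thesis .
qed

section \<open>Asymptotics\<close>

lemma ex_power_9_between:
  assumes "n \<ge> (1::nat)"
  shows "\<exists>k>0. n \<le> 9 ^ k \<and> 9 ^ k \<le> 9 * n"
  using assms
proof (induction n rule: dec_induct)
  case (step n)
  then obtain k :: nat where k: "k > 0" "n \<le> 9 ^ k" "9 ^ k \<le> 9 * n" by blast
  show ?case
  proof (cases "n = 9 ^ k")
    case True
    then show ?thesis by (intro exI[of _ "Suc k"]) auto
  next
    case False
    with k show ?thesis by (intro exI[of _ k]) auto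
  qed
qed (auto intro: exI[of _ 1])

theorem theorem3p5:
  fixes T :: "'a graph"
  assumes "is_tree T"
    and "card (edges T) \<ge> 2"
  shows "(\<lambda>n. real (repeat_number 3 n T)) \<in> O(\<lambda>n. real n powr (3 / 2))"
proof (rule bigoI)
  \<comment> \<open>The constant is the price of rounding \<open>n\<close> up to a power of 9, which
    is at most \<open>9 * n\<close>.\<close>
  show "\<forall>\<^sub>F n in at_top. norm (real (repeat_number 3 n T)) \<le> 9 powr (3 / 2) * norm (real n powr (3 / 2))"
    using eventually_ge_at_top[of 1]
  proof eventually_elim
    case (elim n)
    then obtain k :: nat where k: "k > 0" "n \<le> 9 ^ k" "9 ^ k \<le> 9 * n"
      using ex_power_9_between by blast
    have "real (repeat_number 3 n T) \<le> real (27 ^ k)"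
      using repeat_number_3_le[OF assms k(1,2)] by (rule of_nat_mono)
    also have "\<dots> = real (9 ^ k) powr (3 / 2)"
    proof -
      have "real (9 ^ k) = real (3 ^ k) powr 2" "real (27 ^ k) = real (3 ^ k) powr 3"
        by (simp_all add: power2_eq_square power3_eq_cube flip: power_mult_distrib)
      then show ?thesis
        by (simp only: powr_powr) simp
    qed
    also have "\<dots> \<le> (9 * real n) powr (3 / 2)"
      using k(3) by (intro powr_mono2) (simp_all flip: of_nat_mult of_nat_power)
    also have "\<dots> = 9 powr (3 / 2) * norm (real n powr (3 / 2))"
      by (simp add: powr_mult)
    finally show ?case by simp
  qed
qed

end
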